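(* Let $m,k\ge1$ be integers. Under the two parameter Rayleigh model with joint prior $\pi(\mu,\sigma)\propto\frac1\sigma\exp\{-\tau(\mu-\xi)^2\}$, $\sigma>0$, $\mu\in\mathbb{R}$ (where $\xi\in\mathbb{R}$ and $\tau>0$ are fixed), the Bayes point predictor of the $m$-th repair time $U_{m(k)}$ under squared error loss (the posterior predictive mean) is $$\widehat{U}_{m(k)}=E(U_{m(k)}|\mathbf{x})=A_1(\mathbf{x})\left[\frac{\Gamma(m+\frac12)\,\Gamma(d-\frac12)}{\Gamma(m)\,\Gamma(d)\sqrt{k}}\int_{-\infty}^{x_1}\sqrt{\delta^*(t|\mathbf{x})}\;g(t,t,0;\mathbf{x},\boldsymbol{\eta})\,dt+\int_{-\infty}^{x_1}t\,g(t,t,0;\mathbf{x},\boldsymbol{\eta})\,dt\right],$$ where $0^0$ is defined to be $1$, $\boldsymbol{\eta}=(\tau,\xi,k,d)$, $$g(t,u,j;\mathbf{x},\boldsymbol{\eta})=\frac{k^j\exp\{-\tau(t-\xi)^2\}(u-t)^{2j}\prod_{i=1}^d(x_i-t)}{[k(u-t)^2+\delta^*(t|\mathbf{x})]^{d+j}},$$ $$\delta^*(t|\mathbf{x})=\sum_{i=1}^d(x_i-t)^2+(n-d)(T_0-t)^2,\qquad A_1(\mathbf{x})^{-1}=\int_{-\infty}^{x_1}\frac{\exp\{-\tau(\mu-\xi)^2\}\prod_{i=1}^d(x_i-\mu)}{[\delta^*(\mu|\mathbf{x})]^d}\,d\mu .$$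
   Context: Model. $n$ iid component lifetimes have density $f(x;\mu,\sigma)=\frac{x-\mu}{\sigma}\exp\{-\frac{(x-\mu)^2}{2\sigma}\}$, $x>\mu$ (two parameter Rayleigh distribution, $\mu\in\mathbb{R}$, $\sigma>0$ unknown). They are observed under Type-I hybrid censoring with pre-fixed integer $1\le r\le n$ and time $T$: the test stops at $T_0=\min\{x_{r:n},T\}$, where $x_{1:n}<\cdots<x_{n:n}$ are the ordered lifetimes; $d=\max\{s:s\le r,\ x_{s:n}\le T\}$, assumed $\ge1$; the observed sample is $\mathbf{x}=(x_1,\ldots,x_d)=(x_{1:n},\ldots,x_{d:n})$. Thus $x_1<\cdots<x_d\le T_0$, and $T_0=x_d$ if $d=r$ while $T_0=T$ if $d<r$. The likelihood is $$L(\mu,\sigma|\mathbf{x})\propto\sigma^{-d}\Big[\prod_{i=1}^d(x_i-\mu)\Big]\exp\Big\{-\frac{1}{2\sigma}\Big[\sum_{i=1}^d(x_i-\mu)^2+(n-d)(T_0-\mu)^2\Big]\Big\},\quad \mu<x_1,\ \sigma>0.$$ Posterior. $\pi^*(\mu,\sigma|\mathbf{x})$ is the probability density on $\{\mu<x_1,\ \sigma>0\}$ proportional to $L(\mu,\sigma|\mathbf{x})\,\pi(\mu,\sigma)$; it is assumed that it is proper, i.e. that the integral defining $A_1(\mathbf{x})^{-1}$ is finite. Repair times. $U_{m(k)}$ is the $m$-th minimal repair time of a series system of $k$ independent identical components with the same lifetime distribution, independent of the sample given $(\mu,\sigma)$; it is distributed as the $m$-th upper $k$-record value, with density $$f_{U_{m(k)}}(u|\mu,\sigma)=\frac{k^m(u-\mu)^{2m-1}}{\Gamma(m)\sigma^m2^{m-1}}\exp\Big\{-\frac{k(u-\mu)^2}{2\sigma}\Big\},\qquad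 u>\mu$$ (and $0$ for $u\le\mu$). $E(\cdot|\mathbf{x})$ is expectation under the posterior predictive density $h^*_{U_{m(k)}}(u|\mathbf{x})=\int_{-\infty}^{\min(u,x_1)}\int_0^\infty f_{U_{m(k)}}(u|\mu,\sigma)\,\pi^*(\mu,\sigma|\mathbf{x})\,d\sigma\,d\mu$, $u\in\mathbb{R}$. *)

theory Defs
  imports "HOL-Analysis.Analysis"
begin

subsection \<open>The two parameter Rayleigh lifetime model\<close>

definition rayleigh_density :: "real \<Rightarrow> real \<Rightarrow> real \<Rightarrow> real" where
  "rayleigh_density \<mu> \<sigma> t =
     (if t > \<mu> then (t - \<mu>) / \<sigma> * exp (- ((t - \<mu>)\<^sup>2 / (2 * \<sigma>))) else 0)"

definition rayleigh_survival :: "real \<Rightarrow> real \<Rightarrow> real \<Rightarrow> real" where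
  "rayleigh_survival \<mu> \<sigma> t = (LINT s:{t<..}|lborel. rayleigh_density \<mu> \<sigma> s)"

subsection \<open>Type-I hybrid censoring\<close>

text \<open>The lifetimes are y 1, ..., y n; order statistics are indexed from 1 to n.\<close>

definition order_stat :: "nat \<Rightarrow> (nat \<Rightarrow> real) \<Rightarrow> nat \<Rightarrow> real" where
  "order_stat n y s = sort (map y [1..<Suc n]) ! (s - 1)"

definition stop_time :: "nat \<Rightarrow> nat \<Rightarrow> real \<Rightarrow> (nat \<Rightarrow> real) \<Rightarrow> real" where
  "stop_time n r T y = min (order_stat n y r) T"

text \<open>The inserted 0 only covers the case that no failure is observed.\<close>

definition num_failures :: "nat \<Rightarrow> nat \<Rightarrow> real \<Rightarrow> (nat \<Rightarrow> real) \<Rightarrow> nat" where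
  "num_failures n r T y = Max (insert 0 {s \<in> {1..r}. order_stat n y s \<le> T})"

text \<open>From here on only the observed data enter: the number d of failures, the stopping time T0
  and the failure times x 1, ..., x d (other values of x are never used). The likelihood is the
  joint density of d observed failures, with the other n - d components surviving T0.\<close>

definition likelihood :: "nat \<Rightarrow> nat \<Rightarrow> real \<Rightarrow> (nat \<Rightarrow> real) \<Rightarrow> real \<Rightarrow> real \<Rightarrow> real" where
  "likelihood n d T0 x \<mu> \<sigma> =
     fact n / fact (n - d) * (\<Prod>i=1..d. rayleigh_density \<mu> \<sigma> (x i))
       * rayleigh_survival \<mu> \<sigma> T0 ^ (n - d)"

definition delta_star :: "nat \<Rightarrow> nat \<Rightarrow> real \<Rightarrow> (nat \<Rightarrow> real) \<Rightarrow> real \<Rightarrow> real" where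
  "delta_star n d T0 x t = (\<Sum>i=1..d. (x i - t)\<^sup>2) + real (n - d) * (T0 - t)\<^sup>2"

lemma rayleigh_survival_eq:
  assumes "\<mu> \<le> t" "\<sigma> > 0"
  shows "rayleigh_survival \<mu> \<sigma> t = exp (- ((t - \<mu>)\<^sup>2 / (2 * \<sigma>)))"
proof -
  define f where "f = (\<lambda>s. (s - \<mu>) / \<sigma> * exp (- ((s - \<mu>)\<^sup>2 / (2 * \<sigma>))))"
  define F where "F = (\<lambda>s. - exp (- ((s - \<mu>)\<^sup>2 / (2 * \<sigma>))))"
  have fm: "f \<in> borel_measurable borel"
    unfolding f_def by measurable
  have sq: "filterlim (\<lambda>s. (s - \<mu>)\<^sup>2 / (2 * \<sigma>)) at_top at_top"
  proof -
    have "filterlim (\<lambda>s. s - \<mu>) at_top at_top"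
      using filterlim_tendsto_add_at_top[OF tendsto_const filterlim_ident, of "- \<mu>"] by simp
    then have "filterlim (\<lambda>s. (s - \<mu>)\<^sup>2) at_top at_top"
      by (intro filterlim_pow_at_top) auto
    from filterlim_tendsto_pos_mult_at_top[OF tendsto_const _ this, of "1 / (2 * \<sigma>)"]
    show ?thesis using assms(2) by simp
  qed
  then have "filterlim (\<lambda>s. - ((s - \<mu>)\<^sup>2 / (2 * \<sigma>))) at_bot at_top"
    by (simp add: filterlim_uminus_at_bot)
  from tendsto_minus[OF filterlim_compose[OF exp_at_bot this]]
  have lim: "(F \<longlongrightarrow> 0) at_top"
    by (simp add: F_def)
  have nn: "(\<integral>\<^sup>+s. ennreal (f s) * indicator {t..} s \<partial>lborel) = ennreal (0 - F t)"
  proof (rule nn_integral_FTC_atLeast[OF fm _ _ lim])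
    fix s assume s: "t \<le> s"
    show "(F has_real_derivative f s) (at s)"
      unfolding F_def f_def using assms(2)
      by (auto intro!: derivative_eq_intros simp: field_simps)
    show "0 \<le> f s" unfolding f_def using s assms by auto
  qed
  have "rayleigh_survival \<mu> \<sigma> t = (LINT s|lborel. indicator {t<..} s * f s)"
    unfolding rayleigh_survival_def set_lebesgue_integral_def
    by (rule Bochner_Integration.integral_cong)
      (use assms in \<open>auto simp: rayleigh_density_def f_def indicator_def\<close>)
  also have "\<dots> = enn2real (\<integral>\<^sup>+s. ennreal (indicator {t<..} s * f s) \<partial>lborel)"
    by (rule integral_eq_nn_integral)
      (use assms fm in \<open>auto simp: f_def indicator_def\<close>)
  also have "(\<integral>\<^sup>+s. ennreal (indicator {t<..} s * f s) \<partial>lborel)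
      = (\<integral>\<^sup>+s. ennreal (f s) * indicator {t..} s \<partial>lborel)"
    by (rule nn_integral_cong_AE, use AE_lborel_singleton[of t] in eventually_elim)
      (auto simp: indicator_def)
  finally show ?thesis using nn by (simp add: F_def)
qed

lemma likelihood_eq:
  assumes "d \<le> n" "\<mu> < T0" "\<And>i. i \<in> {1..d} \<Longrightarrow> \<mu> < x i" "\<sigma> > 0"
  shows "likelihood n d T0 x \<mu> \<sigma> =
    fact n / fact (n - d) *
      (1 / \<sigma> ^ d * (\<Prod>i=1..d. x i - \<mu>) * exp (- (1 / (2 * \<sigma>) * delta_star n d T0 x \<mu>)))"
proof -
  have a: "(\<Prod>i=1..d. rayleigh_density \<mu> \<sigma> (x i)) =
      (\<Prod>i=1..d. x i - \<mu>) / \<sigma> ^ d * exp (- (\<Sum>i=1..d. (x i - \<mu>)\<^sup>2 / (2 * \<sigma>)))"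
  proof -
    have "(\<Prod>i=1..d. rayleigh_density \<mu> \<sigma> (x i)) =
        (\<Prod>i=1..d. (x i - \<mu>) / \<sigma> * exp (- ((x i - \<mu>)\<^sup>2 / (2 * \<sigma>))))"
      by (rule prod.cong) (use assms(3) in \<open>auto simp: rayleigh_density_def\<close>)
    then show ?thesis
      by (simp only: prod.distrib prod_dividef prod_constant exp_sum[OF finite_atLeastAtMost, symmetric]
            sum_negf card_atLeastAtMost) simp
  qed
  have b: "rayleigh_survival \<mu> \<sigma> T0 ^ (n - d) = exp (- (real (n - d) * (T0 - \<mu>)\<^sup>2 / (2 * \<sigma>)))"
    using assms by (simp add: rayleigh_survival_eq flip: exp_of_nat_mult)
  have c: "- (1 / (2 * \<sigma>) * delta_star n d T0 x \<mu>) =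
      - (\<Sum>i=1..d. (x i - \<mu>)\<^sup>2 / (2 * \<sigma>)) + - (real (n - d) * (T0 - \<mu>)\<^sup>2 / (2 * \<sigma>))"
    by (simp add: delta_star_def add_divide_distrib sum_divide_distrib)
  show ?thesis
    unfolding likelihood_def a b c exp_add by simp
qed

subsection \<open>Posterior and posterior predictive density\<close>

definition posterior ::
  "nat \<Rightarrow> nat \<Rightarrow> real \<Rightarrow> (nat \<Rightarrow> real) \<Rightarrow> (real \<Rightarrow> real \<Rightarrow> real) \<Rightarrow> real \<Rightarrow> real \<Rightarrow> real" where
  "posterior n d T0 x prior \<mu> \<sigma> =
     (if \<mu> < x 1 \<and> \<sigma> > 0 then
        likelihood n d T0 x \<mu> \<sigma> * prior \<mu> \<sigma>
          / (LINT z:{..<x 1} \<times> {0<..}|lborel.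
               likelihood n d T0 x (fst z) (snd z) * prior (fst z) (snd z))
      else 0)"

definition repair_density :: "nat \<Rightarrow> nat \<Rightarrow> real \<Rightarrow> real \<Rightarrow> real \<Rightarrow> real" where
  "repair_density m k \<mu> \<sigma> u =
     (if u > \<mu> then
        real k ^ m * (u - \<mu>) ^ (2 * m - 1) / (Gamma (real m) * \<sigma> ^ m * 2 ^ (m - 1))
          * exp (- (real k * (u - \<mu>)\<^sup>2 / (2 * \<sigma>)))
      else 0)"

definition predictive_density ::
  "nat \<Rightarrow> nat \<Rightarrow> nat \<Rightarrow> nat \<Rightarrow> real \<Rightarrow> (nat \<Rightarrow> real) \<Rightarrow> (real \<Rightarrow> real \<Rightarrow> real) \<Rightarrow> real \<Rightarrow> real" where
  "predictive_density m k n d T0 x prior u =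
     (LINT \<mu>:{..<min u (x 1)}|lborel. LINT \<sigma>:{0<..}|lborel.
        repair_density m k \<mu> \<sigma> u * posterior n d T0 x prior \<mu> \<sigma>)"

definition bayes_predictor ::
  "nat \<Rightarrow> nat \<Rightarrow> nat \<Rightarrow> nat \<Rightarrow> real \<Rightarrow> (nat \<Rightarrow> real) \<Rightarrow> (real \<Rightarrow> real \<Rightarrow> real) \<Rightarrow> real" where
  "bayes_predictor m k n d T0 x prior = (LINT u|lborel. u * predictive_density m k n d T0 x prior u)"

subsection \<open>The functions in the closed form\<close>

text \<open>The argument list is (t, u, j; n, T0, x, tau, xi, k, d). The convention that 0 to the power
  0 is 1 holds for the power operation used here.\<close>

definition g_fun :: "real \<Rightarrow> real \<Rightarrow> nat \<Rightarrow> nat \<Rightarrow> real \<Rightarrow> (nat \<Rightarrow> real) \<Rightarrow>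
    real \<Rightarrow> real \<Rightarrow> nat \<Rightarrow> nat \<Rightarrow> real" where
  "g_fun t u j n T0 x \<tau> \<xi> k d =
     real k ^ j * exp (- (\<tau> * (t - \<xi>)\<^sup>2)) * (u - t) ^ (2 * j) * (\<Prod>i=1..d. x i - t)
       / (real k * (u - t)\<^sup>2 + delta_star n d T0 x t) ^ (d + j)"

definition A1_integrand ::
  "nat \<Rightarrow> nat \<Rightarrow> real \<Rightarrow> (nat \<Rightarrow> real) \<Rightarrow> real \<Rightarrow> real \<Rightarrow> real \<Rightarrow> real" where
  "A1_integrand n d T0 x \<tau> \<xi> \<mu> =
     exp (- (\<tau> * (\<mu> - \<xi>)\<^sup>2)) * (\<Prod>i=1..d. x i - \<mu>) / delta_star n d T0 x \<mu> ^ d"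

definition A1 :: "nat \<Rightarrow> nat \<Rightarrow> real \<Rightarrow> (nat \<Rightarrow> real) \<Rightarrow> real \<Rightarrow> real \<Rightarrow> real" where
  "A1 n d T0 x \<tau> \<xi> = inverse (LINT \<mu>:{..<x 1}|lborel. A1_integrand n d T0 x \<tau> \<xi> \<mu>)"

end

theory Submission
  imports Defs "HOL-Probability.Distributions"
begin

text \<open>Given the parameters, the repair time is \<open>\<mu>\<close> plus a Rayleigh-type excess whose mean is
  \<open>Gamma (m + 1/2) / Gamma m * sqrt (2 * \<sigma> / k)\<close>. Integrating out \<open>u\<close> first therefore turns the
  predictive mean into the posterior mean of \<open>\<mu>\<close> plus a constant times the posterior mean of
  \<open>sqrt \<sigma>\<close>. In \<open>\<sigma>\<close> the posterior is an inverse gamma kernel, proportional to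
  \<open>\<sigma> powr (- d - 1) * exp (- \<delta>\<^sup>*(\<mu>) / (2 * \<sigma>))\<close>, and the factor \<open>sqrt \<sigma>\<close> only shifts its shape from
  \<open>d\<close> to \<open>d - 1/2\<close>. Integrating out \<open>\<sigma>\<close> thus leaves the two integrals over \<open>\<mu> < x 1\<close> of the
  closed form: with shape \<open>d - 1/2\<close> one divides by \<open>\<delta>\<^sup>* powr (d - 1/2)\<close>, whence the factor \<open>sqrt \<delta>\<^sup>*\<close>.
  The same computation with weight 1 evaluates the normalising constant of the posterior.

  The interchanges of integrals rest on \<open>has_bochner_integral_weighted_kernel\<close>, a form of Fubini's
  theorem for a signed weight times a nonnegative kernel with known inner integral. It is used once
  for \<open>\<sigma>\<close> given \<open>\<mu>\<close> (\<open>has_bochner_integral_inverse_gamma_mixture\<close>) and once for \<open>u\<close> given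
  \<open>(\<mu>, \<sigma>)\<close> (\<open>has_bochner_integral_predictive_mean\<close>). The integrals over \<open>\<mu>\<close> converge because
  both \<open>\<mu>\<close> and \<open>sqrt \<delta>\<^sup>*\<close> grow at most linearly: near \<open>x 1\<close> properness of the posterior suffices,
  and near minus infinity the Gaussian factor of the prior dominates.\<close>

section \<open>Gamma-type integrals\<close>

text \<open>The substitution \<open>s = c * v powr p\<close> in Euler's integral. Allowing both signs of \<open>p\<close> covers the
  two integrals needed later: \<open>p = 2\<close> gives the moments of the repair time, \<open>p = -1\<close> the
  normalisation of the inverse gamma density.\<close>

lemma has_bochner_integral_power_gamma:
  fixes p a c :: real
  assumes "p \<noteq> 0" "a > 0" "c > 0"
  shows "has_bochner_integral lborel
    (\<lambda>v. indicator {0<..} v * (v powr (p * a - 1) * exp (- (c * v powr p))))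
    (Gamma a / (\<bar>p\<bar> * c powr a))"
proof -
  define f :: "real \<Rightarrow> real" where "f = (\<lambda>t. t powr (a - 1) / exp t)"
  define g where "g = (\<lambda>v. c * v powr p)"
  define h where "h = (\<lambda>v. v powr (p * a - 1) * exp (- (c * v powr p)))"
  define K where "K = \<bar>p\<bar> * c powr a"
  have K: "K > 0" using assms by (simp add: K_def)
  have img: "g ` {0<..} = {0<..}"
  proof
    show "g ` {0<..} \<subseteq> {0<..}" using assms by (auto simp: g_def)
    show "{0<..} \<subseteq> g ` {0<..}"
    proof
      fix s :: real assume "s \<in> {0<..}"
      then have s0: "s > 0" and s: "s / c > 0" using assms by simp_all
      then have "((s / c) powr (1 / p)) powr p = s / c"
        using assms s0 by (simp add: powr_powr)
      then have "g ((s / c) powr (1 / p)) = s" using assms by (simp add: g_def)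
      moreover have "(s / c) powr (1 / p) \<in> {0<..}" using s by auto
      ultimately show "s \<in> g ` {0<..}" by (metis imageI)
    qed
  qed
  have inj: "inj_on g {0<..}"
  proof (rule inj_onI)
    fix v w :: real assume "v \<in> {0<..}" "w \<in> {0<..}" "g v = g w"
    then have "v powr p = w powr p" "v > 0" "w > 0" using assms by (auto simp: g_def)
    then have "(v powr p) powr (1 / p) = (w powr p) powr (1 / p)" by simp
    then show "v = w" using assms \<open>v > 0\<close> \<open>w > 0\<close> by (simp add: powr_powr)
  qed
  have der: "(g has_field_derivative c * (p * v powr (p - 1))) (at v within {0<..})"
    if "v \<in> {0<..}" for v
    using that unfolding g_def by (auto intro!: derivative_eq_intros)
  have Gi: "(f has_integral Gamma a) {0<..}"
  proof -
    have "(f has_integral Gamma a) {0..}"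
      unfolding f_def by (rule Gamma_integral_real) fact
    then show ?thesis
      using has_integral_interior[of "{0::real..}" f] by simp
  qed
  have Ga: "f absolutely_integrable_on {0<..}"
    by (rule nonnegative_absolutely_integrable_1) (use Gi in \<open>auto simp: f_def\<close>)
  \<comment> \<open>The factor \<open>K\<close> absorbs the constants of \<open>g' * f (g v)\<close>; the exponents of \<open>v\<close> add up to
     \<open>(p - 1) + p * (a - 1) = p * a - 1\<close>.\<close>
  have eq: "\<bar>c * (p * v powr (p - 1))\<bar> * f (g v) = K * h v" if "v \<in> {0<..}" for v
  proof -
    have v: "v > 0" using that by simp
    have "p * a - 1 = (p - 1) + p * (a - 1)" by (simp add: algebra_simps)
    then have 1: "v powr (p * a - 1) = v powr (p - 1) * v powr (p * (a - 1))"
      by (metis powr_add)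
    have 2: "c powr a = c * c powr (a - 1)"
      using assms by (simp add: powr_mult_base)
    show ?thesis
      using v assms by (simp add: f_def g_def h_def K_def abs_mult powr_mult powr_powr 1 2 exp_minus divide_simps)
  qed
  let ?l = "\<lambda>v. \<bar>c * (p * v powr (p - 1))\<bar> * f (g v)"
  have "?l absolutely_integrable_on {0<..} \<and> integral {0<..} ?l = Gamma a"
    using Ga Gi
    by (subst has_absolute_integral_change_of_variables_1'[OF _ der inj]) (auto simp: img integral_unique)
  then have I: "(\<lambda>v. K * h v) absolutely_integrable_on {0<..}"
    "integral {0<..} (\<lambda>v. K * h v) = Gamma a"
    using set_integrable_cong[of lebesgue lebesgue "{0<..}" "{0<..}" ?l "\<lambda>v. K * h v"]
      integral_cong[of "{0<..}" ?l "\<lambda>v. K * h v"] eq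
    by auto
  have "((\<lambda>v. K * h v) has_integral Gamma a) {0<..}"
    using I by (metis absolutely_integrable_on_def integrable_integral)
  from has_integral_mult_right[OF this, of "1 / K"] K
  have hi: "(h has_integral Gamma a / K) {0<..}" by simp
  have hm: "(\<lambda>v. indicator {0<..} v * h v) \<in> borel_measurable borel"
    unfolding h_def by measurable
  have "(\<lambda>v. indicator {0<..} v * h v) = (\<lambda>v. if v \<in> {0<..} then h v else 0)"
    by (auto simp: indicator_def)
  then have "((\<lambda>v. indicator {0<..} v * h v) has_integral Gamma a / K) UNIV"
    using hi by (simp only: has_integral_restrict_UNIV)
  then have "(\<integral>\<^sup>+v. ennreal (indicator {0<..} v * h v) \<partial>lborel) = ennreal (Gamma a / K)"
    by (intro nn_integral_has_integral_lborel hm) (auto simp: h_def)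
  then show ?thesis
    unfolding h_def[symmetric] K_def[symmetric]
    using hm K assms(2)
    by (intro has_bochner_integral_nn_integral)
       (auto simp: h_def Gamma_real_pos less_imp_le)
qed

lemma has_bochner_integral_inverse_gamma:
  fixes a b :: real
  assumes "a > 0" "b > 0"
  shows "has_bochner_integral lborel
    (\<lambda>\<sigma>. indicator {0<..} \<sigma> * (\<sigma> powr (- a - 1) * exp (- (b / \<sigma>)))) (Gamma a / b powr a)"
proof -
  have "(\<lambda>v. indicator {0<..} v * (v powr (-1 * a - 1) * exp (- (b * v powr -1)))) =
    (\<lambda>\<sigma>. indicator {0<..} \<sigma> * (\<sigma> powr (- a - 1) * exp (- (b / \<sigma>))))"
    by (auto simp: indicator_def powr_minus divide_inverse)
  then show ?thesis
    using has_bochner_integral_power_gamma[of "-1" a b] assms by simp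
qed

lemma has_bochner_integral_shifted_rayleigh_moment:
  fixes a c \<mu> :: real
  assumes "a > 0" "c > 0"
  shows "has_bochner_integral lborel
    (\<lambda>u. indicator {\<mu><..} u * ((u - \<mu>) powr (2 * a - 1) * exp (- (c * (u - \<mu>)\<^sup>2))))
    (Gamma a / (2 * c powr a))"
proof -
  have "has_bochner_integral lborel
    (\<lambda>v. indicator {0<..} v * (v powr (2 * a - 1) * exp (- (c * v powr 2)))) (Gamma a / (2 * c powr a))"
    using has_bochner_integral_power_gamma[of 2 a c] assms by simp
  then have "has_bochner_integral lborel
    (\<lambda>u. indicator {0<..} (-\<mu> + 1 * u) * ((-\<mu> + 1 * u) powr (2 * a - 1) * exp (- (c * (-\<mu> + 1 * u) powr 2)))) (Gamma a / (2 * c powr a))"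
    by (subst (asm) lborel_has_bochner_integral_real_affine_iff[of 1 _ _ "-\<mu>"]) auto
  moreover have "(\<lambda>u. indicator {0<..} (-\<mu> + 1 * u) * ((-\<mu> + 1 * u) powr (2 * a - 1) * exp (- (c * (-\<mu> + 1 * u) powr 2)))) =
    (\<lambda>u. indicator {\<mu><..} u * ((u - \<mu>) powr (2 * a - 1) * exp (- (c * (u - \<mu>)\<^sup>2))))"
    by (auto simp: indicator_def fun_eq_iff)
  ultimately show ?thesis by simp
qed

section \<open>Iterated integrals of weighted kernels\<close>

text \<open>Only the kernel has to be nonnegative: its inner integral then equals the inner integral of its
  absolute value, so that absolute convergence for a signed weight \<open>w\<close> reduces to integrability of
  \<open>w * F\<close>, which is also what determines the value.\<close>

lemma (in pair_sigma_finite) has_bochner_integral_weighted_kernel: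
  fixes w :: "'a \<Rightarrow> real" and f :: "'a \<Rightarrow> 'b \<Rightarrow> real"
  assumes w [measurable]: "w \<in> borel_measurable M1"
    and f [measurable]: "case_prod f \<in> borel_measurable (M1 \<Otimes>\<^sub>M M2)"
    and nonneg: "\<And>x y. f x y \<ge> 0"
    and inner: "\<And>x. has_bochner_integral M2 (f x) (F x)"
    and outer: "has_bochner_integral M1 (\<lambda>x. w x * F x) I"
  shows "has_bochner_integral (M1 \<Otimes>\<^sub>M M2) (\<lambda>(x, y). w x * f x y) I"
proof -
  have F: "(\<integral>y. f x y \<partial>M2) = F x" "integrable M2 (f x)" for x
    using inner by (auto simp: has_bochner_integral_iff)
  have F0: "F x \<ge> 0" for x
    using nonneg F(1)[of x] Bochner_Integration.integral_nonneg[of M2 "f x"] by simp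
  have int: "integrable (M1 \<Otimes>\<^sub>M M2) (\<lambda>(x, y). w x * f x y)"
  proof (rule Fubini_integrable)
    have "(\<lambda>x. \<integral>y. norm (case (x, y) of (x, y) \<Rightarrow> w x * f x y) \<partial>M2) = (\<lambda>x. norm (w x * F x))"
      using nonneg F0 by (auto simp: abs_mult F)
    then show "integrable M1 (\<lambda>x. \<integral>y. norm (case (x, y) of (x, y) \<Rightarrow> w x * f x y) \<partial>M2)"
      using outer by (auto simp: has_bochner_integral_iff)
  qed (auto simp: F)
  moreover have "integral\<^sup>L (M1 \<Otimes>\<^sub>M M2) (\<lambda>(x, y). w x * f x y) = I"
    using integral_fst[OF int] outer by (simp add: F has_bochner_integral_iff)
  ultimately show ?thesis by (simp add: has_bochner_integral_iff)
qed

text \<open>Mixing scale parameters \<open>\<delta> \<mu> / 2\<close> with weight \<open>w\<close>: the scale \<open>\<sigma>\<close> is integrated out first. The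
  shape \<open>a\<close> is real because it will be both \<open>d\<close> and \<open>d - 1/2\<close>.\<close>

lemma has_bochner_integral_inverse_gamma_mixture:
  fixes a :: real and S :: "real set" and w \<delta> :: "real \<Rightarrow> real"
  assumes a: "a > 0"
    and S [measurable]: "S \<in> sets borel"
    and w [measurable]: "w \<in> borel_measurable borel"
    and \<delta> [measurable]: "\<delta> \<in> borel_measurable borel"
    and pos: "\<And>\<mu>. \<mu> \<in> S \<Longrightarrow> \<delta> \<mu> > 0"
    and int: "set_integrable lborel S (\<lambda>\<mu>. w \<mu> / \<delta> \<mu> powr a)"
  shows "has_bochner_integral (lborel \<Otimes>\<^sub>M lborel)
    (\<lambda>(\<mu>, \<sigma>). w \<mu> * (indicator S \<mu> * (indicator {0<..} \<sigma> *
       (\<sigma> powr (- a - 1) * exp (- (\<delta> \<mu> / (2 * \<sigma>)))))))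
    (Gamma a * 2 powr a * (LINT \<mu>:S|lborel. w \<mu> / \<delta> \<mu> powr a))"
proof (rule lborel_pair.has_bochner_integral_weighted_kernel)
  show "has_bochner_integral lborel
      (\<lambda>\<sigma>. indicator S \<mu> * (indicator {0<..} \<sigma> * (\<sigma> powr (- a - 1) * exp (- (\<delta> \<mu> / (2 * \<sigma>))))))
      (indicator S \<mu> * (Gamma a * 2 powr a / \<delta> \<mu> powr a))" for \<mu>
  proof (cases "\<mu> \<in> S")
    case True
    then show ?thesis
      using has_bochner_integral_inverse_gamma[OF a, of "\<delta> \<mu> / 2"] pos[OF True]
      by (simp add: powr_divide)
  qed (simp add: has_bochner_integral_zero)
  have "has_bochner_integral lborel (\<lambda>\<mu>. (Gamma a * 2 powr a) * (indicator S \<mu> *\<^sub>R (w \<mu> / \<delta> \<mu> powr a)))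
    (Gamma a * 2 powr a * (LINT \<mu>:S|lborel. w \<mu> / \<delta> \<mu> powr a))"
    using int unfolding set_integrable_def set_lebesgue_integral_def
    by (intro has_bochner_integral_mult_right has_bochner_integral_integrable)
  then show "has_bochner_integral lborel (\<lambda>\<mu>. w \<mu> * (indicator S \<mu> * (Gamma a * 2 powr a / \<delta> \<mu> powr a)))
    (Gamma a * 2 powr a * (LINT \<mu>:S|lborel. w \<mu> / \<delta> \<mu> powr a))"
    by (simp add: mult_ac)
  show "(\<lambda>(\<mu>, \<sigma>). indicator S \<mu> * (indicator {0<..} \<sigma> *
      (\<sigma> powr (- a - 1) * exp (- (\<delta> \<mu> / (2 * \<sigma>))))))
    \<in> borel_measurable (lborel \<Otimes>\<^sub>M lborel)"
    unfolding case_prod_beta by measurable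
qed auto

section \<open>The mean of the predictive distribution\<close>

text \<open>The squared excess \<open>(u - \<mu>)\<^sup>2\<close> of a repair time is gamma distributed with shape \<open>m\<close> and rate
  \<open>k / (2 * \<sigma>)\<close>, so its moments are quotients of Gamma values. The case \<open>j = 0\<close> says that the
  density is normalised, the case \<open>j = 1\<close> gives the mean excess.\<close>

lemma has_bochner_integral_repair_moment:
  fixes m k j :: nat and \<mu> \<sigma> :: real
  assumes "m \<ge> 1" "k \<ge> 1" "\<sigma> > 0"
  shows "has_bochner_integral lborel (\<lambda>u. (u - \<mu>) ^ j * repair_density m k \<mu> \<sigma> u)
    (Gamma (real m + real j / 2) / Gamma (real m) * (2 * \<sigma> / real k) powr (real j / 2))"
proof -
  define c where "c = real k / (2 * \<sigma>)"
  define a where "a = real m + real j / 2"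
  define K where "K = real k ^ m / (Gamma (real m) * \<sigma> ^ m * 2 ^ (m - 1))"
  have c: "c > 0" and a: "a > 0" using assms by (auto simp: c_def a_def)
  have G: "Gamma (real m) > 0" using assms by (intro Gamma_real_pos) simp
  have two: "(2::real) ^ m = 2 * 2 ^ (m - 1)"
    using assms by (metis One_nat_def Suc_le_D diff_Suc_1 power_Suc)
  have K: "K = 2 * c ^ m / Gamma (real m)"
    using assms G unfolding K_def c_def power_divide power_mult_distrib two by (simp add: field_simps)
  have "has_bochner_integral lborel
    (\<lambda>u. K * (indicator {\<mu><..} u * ((u - \<mu>) powr (2 * a - 1) * exp (- (c * (u - \<mu>)\<^sup>2)))))
    (K * (Gamma a / (2 * c powr a)))"
    by (intro has_bochner_integral_mult_right has_bochner_integral_shifted_rayleigh_moment a c)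
  moreover have "K * (Gamma a / (2 * c powr a)) =
      Gamma a / Gamma (real m) * (2 * \<sigma> / real k) powr (real j / 2)"
  proof -
    have 1: "c powr a = c ^ m * c powr (real j / 2)"
      using c by (simp add: a_def powr_add powr_realpow)
    have 2: "2 * \<sigma> / real k = 1 / c" by (simp add: c_def)
    show ?thesis unfolding 1 2 K using c G by (simp add: powr_divide)
  qed
  moreover have "K * (indicator {\<mu><..} u * ((u - \<mu>) powr (2 * a - 1) * exp (- (c * (u - \<mu>)\<^sup>2))))
      = (u - \<mu>) ^ j * repair_density m k \<mu> \<sigma> u" for u
  proof (cases "u > \<mu>")
    case True
    have "2 * a - 1 = real (j + (2 * m - 1))" using assms by (simp add: a_def of_nat_diff)
    then have "(u - \<mu>) powr (2 * a - 1) = (u - \<mu>) ^ j * (u - \<mu>) ^ (2 * m - 1)"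
      using True by (simp add: powr_realpow power_add del: of_nat_add)
    then show ?thesis using True by (simp add: repair_density_def K_def c_def)
  qed (simp add: repair_density_def)
  ultimately show ?thesis by (simp add: a_def)
qed

lemma repair_density_nonneg:
  assumes "m \<ge> 1" "\<sigma> > 0"
  shows "repair_density m k \<mu> \<sigma> u \<ge> 0"
  using assms Gamma_real_pos[of "real m"] by (auto simp: repair_density_def intro!: divide_nonneg_nonneg mult_nonneg_nonneg)

lemma measurable_repair_density [measurable]:
  assumes [measurable]: "f \<in> borel_measurable M" "g \<in> borel_measurable M" "h \<in> borel_measurable M"
  shows "(\<lambda>z. repair_density m k (f z) (g z) (h z)) \<in> borel_measurable M"
  unfolding repair_density_def by measurable

text \<open>Splitting \<open>u = \<mu> + (u - \<mu>)\<close> makes both parts of the integrand a weight in \<open>(\<mu>, \<sigma>)\<close> times a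
  nonnegative kernel in \<open>u\<close>. The inner integral over \<open>u\<close> is 1 for the first part and a multiple of
  \<open>sqrt \<sigma>\<close> for the second.\<close>

lemma has_bochner_integral_predictive_mean:
  fixes m k :: nat and q :: "real \<times> real \<Rightarrow> real"
  assumes mk: "m \<ge> 1" "k \<ge> 1"
    and q [measurable]: "q \<in> borel_measurable borel"
    and supp: "\<And>\<mu> \<sigma>. \<sigma> \<le> 0 \<Longrightarrow> q (\<mu>, \<sigma>) = 0"
    and location: "has_bochner_integral lborel (\<lambda>z. fst z * q z) I"
    and scale: "has_bochner_integral lborel (\<lambda>z. sqrt (snd z) * q z) J"
  shows "has_bochner_integral lborel
    (\<lambda>u. u * (LINT \<mu>|lborel. LINT \<sigma>|lborel. repair_density m k \<mu> \<sigma> u * q (\<mu>, \<sigma>)))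
    (I + Gamma (real m + 1 / 2) / Gamma (real m) * sqrt (2 / real k) * J)"
proof -
  define G where "G = Gamma (real m + 1 / 2) / Gamma (real m) * sqrt (2 / real k)"
  \<comment> \<open>Cutting off \<open>\<sigma> \<le> 0\<close> makes the kernel nonnegative everywhere; there \<open>q\<close> vanishes anyway.\<close>
  define R where "R = (\<lambda>z u. if snd z > 0 then repair_density m k (fst z) (snd z) u else 0)"
  have [measurable]: "(fst :: real \<times> real \<Rightarrow> real) \<in> borel_measurable borel"
    "(snd :: real \<times> real \<Rightarrow> real) \<in> borel_measurable borel"
    by (auto intro!: borel_measurable_continuous_onI continuous_intros)
  have R [measurable]: "(\<lambda>p. R (f p) (g p)) \<in> borel_measurable M"
    if [measurable]: "f \<in> borel_measurable M" "g \<in> borel_measurable M" for f g and M :: "'x measure"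
    unfolding R_def by measurable
  have R0: "R z u \<ge> 0" "(u - fst z) * R z u \<ge> 0" for z u
    using repair_density_nonneg[OF mk(1), of "snd z" k "fst z" u]
    by (cases "u > fst z"; auto simp: R_def; simp add: repair_density_def)+
  have "Gamma (real m) > 0" using mk by (intro Gamma_real_pos) simp
  then have G0: "Gamma (real m) \<noteq> 0" by simp
  have R1: "has_bochner_integral lborel (R z) (if snd z > 0 then 1 else 0)" for z
    using has_bochner_integral_repair_moment[OF mk, of "snd z" "fst z" 0] G0 mk
    by (auto simp: R_def has_bochner_integral_zero)
  have R2: "has_bochner_integral lborel (\<lambda>u. (u - fst z) * R z u) (if snd z > 0 then G * sqrt (snd z) else 0)" for z
    using has_bochner_integral_repair_moment[OF mk, of "snd z" "fst z" 1] mk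
    by (auto simp: R_def G_def has_bochner_integral_zero powr_half_sqrt real_sqrt_mult real_sqrt_divide mult.assoc)
  have supp': "q z = 0" if "\<not> snd z > 0" for z
    using supp[of "snd z" "fst z"] that by simp
  have A: "has_bochner_integral (lborel \<Otimes>\<^sub>M lborel) (\<lambda>(z, u). (fst z * q z) * R z u) I"
  proof (rule lborel_pair.has_bochner_integral_weighted_kernel[OF _ _ R0(1) R1])
    have "(\<lambda>z. fst z * q z * (if snd z > 0 then 1 else 0)) = (\<lambda>z. fst z * q z)"
      using supp' by auto
    then show "has_bochner_integral lborel (\<lambda>z. fst z * q z * (if snd z > 0 then 1 else 0)) I"
      using location by simp
  qed (unfold case_prod_beta, measurable)
  have B: "has_bochner_integral (lborel \<Otimes>\<^sub>M lborel) (\<lambda>(z, u). q z * ((u - fst z) * R z u)) (G * J)"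
  proof (rule lborel_pair.has_bochner_integral_weighted_kernel[OF _ _ R0(2) R2])
    have "(\<lambda>z. q z * (if snd z > 0 then G * sqrt (snd z) else 0)) = (\<lambda>z. G * (sqrt (snd z) * q z))"
      using supp' by auto
    then show "has_bochner_integral lborel (\<lambda>z. q z * (if snd z > 0 then G * sqrt (snd z) else 0)) (G * J)"
      using has_bochner_integral_mult_right[OF scale] by simp
  qed (unfold case_prod_beta, measurable)
  have RQ: "R z u * q z = repair_density m k (fst z) (snd z) u * q z" for z u
    using supp'[of z] by (auto simp: R_def)
  have "(\<lambda>p. (case p of (z, u) \<Rightarrow> (fst z * q z) * R z u) + (case p of (z, u) \<Rightarrow> q z * ((u - fst z) * R z u)))
    = (\<lambda>(z, u). u * (R z u * q z))"
    by (auto simp: algebra_simps)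
  with has_bochner_integral_add[OF A B]
  have joint: "has_bochner_integral (lborel \<Otimes>\<^sub>M lborel) (\<lambda>(z, u). u * (R z u * q z)) (I + G * J)"
    by simp
  then have int: "integrable (lborel \<Otimes>\<^sub>M lborel) (\<lambda>(z, u). u * (R z u * q z))"
    by (simp add: has_bochner_integral_iff)
  have marg: "has_bochner_integral lborel (\<lambda>u. LINT z|lborel. u * (R z u * q z)) (I + G * J)"
    using lborel_pair.integrable_snd[OF int] lborel_pair.integral_snd[OF int] joint
    by (simp add: has_bochner_integral_iff)
  \<comment> \<open>Joint integrability in \<open>(\<mu>, \<sigma>)\<close> is known after multiplication by \<open>u\<close> only, so \<open>u = 0\<close> has to
     be excluded before the inner integral is written as an iterated one.\<close>
  have ae: "AE u in lborel. (LINT z|lborel. u * (R z u * q z)) =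
     u * (LINT \<mu>|lborel. LINT \<sigma>|lborel. repair_density m k \<mu> \<sigma> u * q (\<mu>, \<sigma>))"
    using lborel_pair.AE_integrable_snd[OF int] AE_lborel_singleton[of 0]
  proof eventually_elim
    case (elim u)
    have "integrable lborel (\<lambda>z. R z u * q z)"
      using elim by simp
    then have "integrable (lborel \<Otimes>\<^sub>M lborel) (\<lambda>z. repair_density m k (fst z) (snd z) u * q z)"
      by (simp add: RQ lborel_prod)
    from lborel_pair.integral_fst'[OF this] show ?case
      by (simp add: RQ lborel_prod)
  qed
  show ?thesis
    using marg has_bochner_integral_cong_AE[OF _ _ ae] by (simp add: G_def)
qed

section \<open>Integrability against a Gaussian tail\<close>

text \<open>On \<open>[b - 1, b)\<close> the factor \<open>h\<close> is bounded and \<open>A\<close> is integrable, whatever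
  its singularity at \<open>b\<close>; further left the first absolute moment of a normal
  distribution dominates.\<close>

lemma set_integrable_linear_growth_times_gaussian_tail:
  fixes A h :: "real \<Rightarrow> real" and b C \<tau> \<xi> :: real
  assumes "\<tau> > 0"
    and A: "set_integrable lborel {..<b} A"
    and tail: "\<And>t. t \<le> b - 1 \<Longrightarrow> \<bar>A t\<bar> \<le> exp (- (\<tau> * (t - \<xi>)\<^sup>2))"
    and h [measurable]: "h \<in> borel_measurable borel"
    and growth: "\<And>t. \<bar>h t\<bar> \<le> C * (1 + \<bar>t - \<xi>\<bar>)"
  shows "set_integrable lborel {..<b} (\<lambda>t. h t * A t)"
proof -
  define e where "e = (\<lambda>t. exp (- (\<tau> * (t - \<xi>)\<^sup>2)))"
  define D where "D = 2 + \<bar>b - \<xi>\<bar>"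
  define s where "s = sqrt (1 / (2 * \<tau>))"
  have s: "s\<^sup>2 = 1 / (2 * \<tau>)" "s > 0" using \<open>\<tau> > 0\<close> by (auto simp: s_def)
  have e: "integrable lborel (\<lambda>t. e t * \<bar>t - \<xi>\<bar> ^ j)" for j :: nat
  proof -
    have "integrable lborel (\<lambda>t. sqrt (2 * pi * s\<^sup>2) * (normal_density \<xi> s t * \<bar>t - \<xi>\<bar> ^ j))"
      by (intro integrable_mult_right integrable_normal_moment_abs s)
    moreover have "sqrt (2 * pi * s\<^sup>2) * normal_density \<xi> s t = e t" for t
      using s \<open>\<tau> > 0\<close> by (simp add: normal_density_def e_def)
    ultimately show ?thesis by (simp add: mult.assoc[symmetric])
  qed
  have C: "C \<ge> 0" using growth[of \<xi>] abs_ge_zero[of "h \<xi>"] by simp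
  \<comment> \<open>The powers 0 and 1 are written out to match the absolute normal moments in \<open>e\<close>.\<close>
  have dom: "integrable lborel
    (\<lambda>t. C * D * \<bar>indicator {..<b} t *\<^sub>R A t\<bar> + C * (e t * \<bar>t - \<xi>\<bar> ^ 0 + e t * \<bar>t - \<xi>\<bar> ^ 1))"
    using A unfolding set_integrable_def
    by (intro Bochner_Integration.integrable_add integrable_mult_right integrable_abs e)
  have [measurable]: "(\<lambda>t. indicator {..<b} t *\<^sub>R A t) \<in> borel_measurable borel"
    using A unfolding set_integrable_def by (auto dest: borel_measurable_integrable)
  have meas: "(\<lambda>t. indicator {..<b} t *\<^sub>R (h t * A t)) \<in> borel_measurable lborel"
  proof -
    have "(\<lambda>t. h t * (indicator {..<b} t *\<^sub>R A t)) \<in> borel_measurable borel" by measurable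
    then show ?thesis by (simp add: mult_ac)
  qed
  show ?thesis
    unfolding set_integrable_def
  proof (rule Bochner_Integration.integrable_bound[OF dom meas], rule AE_I2)
    fix t
    have e0: "e t > 0" by (simp add: e_def)
    have rhs0: "C * (e t * \<bar>t - \<xi>\<bar> ^ 0 + e t * \<bar>t - \<xi>\<bar> ^ 1) \<ge> 0" "C * D * \<bar>A t\<bar> \<ge> 0"
      using C e0 by (auto simp: D_def)
    have "\<bar>h t * A t\<bar> \<le> C * D * \<bar>A t\<bar> + C * (e t * \<bar>t - \<xi>\<bar> ^ 0 + e t * \<bar>t - \<xi>\<bar> ^ 1)" if "t < b"
    proof (cases "t \<le> b - 1")
      case True
      have "\<bar>h t * A t\<bar> \<le> (C * (1 + \<bar>t - \<xi>\<bar>)) * e t"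
        unfolding abs_mult e_def by (intro mult_mono growth tail True) (use C in auto)
      also have "\<dots> = C * (e t * \<bar>t - \<xi>\<bar> ^ 0 + e t * \<bar>t - \<xi>\<bar> ^ 1)" by (simp add: algebra_simps)
      finally show ?thesis using rhs0(2) by linarith
    next
      case False
      then have "1 + \<bar>t - \<xi>\<bar> \<le> D" using that by (auto simp: D_def)
      then have "\<bar>h t\<bar> \<le> C * D" using growth[of t] C by (meson mult_left_mono order_trans)
      then have "\<bar>h t * A t\<bar> \<le> C * D * \<bar>A t\<bar>" unfolding abs_mult by (intro mult_right_mono) auto
      then show ?thesis using rhs0(1) by linarith
    qed
    then show "norm (indicator {..<b} t *\<^sub>R (h t * A t)) \<le>
      norm (C * D * \<bar>indicator {..<b} t *\<^sub>R A t\<bar> + C * (e t * \<bar>t - \<xi>\<bar> ^ 0 + e t * \<bar>t - \<xi>\<bar> ^ 1))"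
      using rhs0 by (auto simp: indicator_def abs_mult)
  qed
qed

section \<open>The censored sample\<close>

lemma order_stat_mono:
  assumes "1 \<le> i" "i \<le> j" "j \<le> n"
  shows "order_stat n y i \<le> order_stat n y j"
  unfolding order_stat_def by (rule sorted_nth_mono) (use assms in auto)

text \<open>All that the censoring scheme contributes to the integrals: the observed failure times and the
  stopping time lie at or beyond the first failure, so for \<open>\<mu> < x 1\<close> all factors of the likelihood
  are in the support of the lifetime distribution.\<close>

lemma hybrid_censored_sample:
  assumes "1 \<le> r" "r \<le> n"
    and T0: "T0 = stop_time n r T y"
    and d: "d = num_failures n r T y" "1 \<le> d"
    and x: "\<And>i. i \<in> {1..d} \<Longrightarrow> x i = order_stat n y i"
  shows "d \<le> n" "x 1 \<le> T0" "\<And>i. i \<in> {1..d} \<Longrightarrow> x 1 \<le> x i"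
proof -
  have "d \<in> insert 0 {s \<in> {1..r}. order_stat n y s \<le> T}"
    unfolding d(1) num_failures_def by (rule Max_in) auto
  then have dr: "d \<le> r" "order_stat n y d \<le> T" using d(2) by auto
  show dn: "d \<le> n" using dr assms(2) by simp
  have x1: "x 1 = order_stat n y 1" using x d(2) by simp
  have "order_stat n y 1 \<le> order_stat n y d" using d(2) dn by (intro order_stat_mono) auto
  moreover have "order_stat n y 1 \<le> order_stat n y r" using assms by (intro order_stat_mono) auto
  ultimately show "x 1 \<le> T0" using dr unfolding x1 T0 stop_time_def by simp
  show "x 1 \<le> x i" if "i \<in> {1..d}" for i
    using that dn order_stat_mono[of 1 i n y] unfolding x1 x[OF that] by simp
qed

section \<open>Growth of the integrands\<close>

lemma measurable_delta_star [measurable]: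
  assumes [measurable]: "f \<in> borel_measurable M"
  shows "(\<lambda>z. delta_star n d T0 x (f z)) \<in> borel_measurable M"
  unfolding delta_star_def by measurable

lemma delta_star_pos:
  assumes "1 \<le> d" "t < x 1"
  shows "delta_star n d T0 x t > 0"
proof -
  have "0 < (x 1 - t)\<^sup>2" using assms by simp
  also have "\<dots> \<le> (\<Sum>i=1..d. (x i - t)\<^sup>2)"
    using assms by (intro member_le_sum) auto
  finally show ?thesis unfolding delta_star_def by (intro add_pos_nonneg) auto
qed

text \<open>\<open>\<delta>\<^sup>*\<close> is a sum of squares of distances to \<open>t\<close>, each at most linear in the distance of \<open>t\<close> from
  the centre \<open>\<xi>\<close> of the prior.\<close>

lemma sqrt_delta_star_linear_growth:
  "\<exists>C. \<forall>t. \<bar>sqrt (delta_star n d T0 x t)\<bar> \<le> C * (1 + \<bar>t - \<xi>\<bar>)"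
proof (intro exI allI)
  fix t
  define K where "K = (\<Sum>i=1..d. (1 + \<bar>x i - \<xi>\<bar>)\<^sup>2) + real (n - d) * (1 + \<bar>T0 - \<xi>\<bar>)\<^sup>2"
  have sq: "(z - t)\<^sup>2 \<le> (1 + \<bar>z - \<xi>\<bar>)\<^sup>2 * (1 + \<bar>t - \<xi>\<bar>)\<^sup>2" for z
  proof -
    have "\<bar>z - t\<bar> \<le> (1 + \<bar>z - \<xi>\<bar>) * (1 + \<bar>t - \<xi>\<bar>)"
      by (rule order_trans[of _ "\<bar>z - \<xi>\<bar> + \<bar>t - \<xi>\<bar>"]) (auto simp: algebra_simps)
    then have "\<bar>z - t\<bar>\<^sup>2 \<le> ((1 + \<bar>z - \<xi>\<bar>) * (1 + \<bar>t - \<xi>\<bar>))\<^sup>2" by (intro power_mono) auto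
    then show ?thesis by (simp add: power_mult_distrib)
  qed
  have "delta_star n d T0 x t \<le> (\<Sum>i=1..d. (1 + \<bar>x i - \<xi>\<bar>)\<^sup>2 * (1 + \<bar>t - \<xi>\<bar>)\<^sup>2)
      + real (n - d) * ((1 + \<bar>T0 - \<xi>\<bar>)\<^sup>2 * (1 + \<bar>t - \<xi>\<bar>)\<^sup>2)"
    unfolding delta_star_def by (intro add_mono sum_mono mult_left_mono sq) auto
  also have "\<dots> = K * (1 + \<bar>t - \<xi>\<bar>)\<^sup>2"
    by (simp add: K_def sum_distrib_right distrib_right)
  finally have "sqrt (delta_star n d T0 x t) \<le> sqrt (K * (1 + \<bar>t - \<xi>\<bar>)\<^sup>2)"
    by simp
  moreover have "0 \<le> delta_star n d T0 x t"
    unfolding delta_star_def by (intro add_nonneg_nonneg sum_nonneg) auto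
  ultimately show "\<bar>sqrt (delta_star n d T0 x t)\<bar> \<le> sqrt K * (1 + \<bar>t - \<xi>\<bar>)"
    by (simp add: real_sqrt_mult)
qed

text \<open>To the left of \<open>x 1 - 1\<close> all distances \<open>x i - t\<close> are at least 1, hence bounded by their squares
  and so by \<open>\<delta>\<^sup>*\<close>; the algebraic part of the integrand is then at most 1.\<close>

lemma A1_integrand_gaussian_tail:
  assumes d: "1 \<le> d" and min: "\<And>i. i \<in> {1..d} \<Longrightarrow> x 1 \<le> x i" and t: "t \<le> x 1 - 1"
  shows "\<bar>A1_integrand n d T0 x \<tau> \<xi> t\<bar> \<le> exp (- (\<tau> * (t - \<xi>)\<^sup>2))"
proof -
  let ?D = "delta_star n d T0 x t"
  have ge1: "1 \<le> x i - t" if "i \<in> {1..d}" for i using min[OF that] t by linarith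
  then have ge0: "0 \<le> x i - t" if "i \<in> {1..d}" for i using that by fastforce
  have le: "x i - t \<le> ?D" if i: "i \<in> {1..d}" for i
  proof -
    have "x i - t \<le> (x i - t)\<^sup>2" using ge1[OF i] by (simp add: self_le_power)
    also have "\<dots> \<le> (\<Sum>i=1..d. (x i - t)\<^sup>2)" using i by (intro member_le_sum) auto
    also have "\<dots> \<le> ?D" unfolding delta_star_def by simp
    finally show ?thesis .
  qed
  have D: "?D > 0" using delta_star_pos[of d t x] d t by simp
  have "(\<Prod>i=1..d. x i - t) \<le> (\<Prod>i=1..d. ?D)"
    using le ge0 by (intro prod_mono) blast
  then have "(\<Prod>i=1..d. x i - t) \<le> ?D ^ d" by simp
  moreover have "0 \<le> (\<Prod>i=1..d. x i - t)"
    using ge0 by (intro prod_nonneg) blast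
  ultimately have "\<bar>(\<Prod>i=1..d. x i - t) / ?D ^ d\<bar> \<le> 1" using D by (simp add: divide_le_eq)
  then have "exp (- (\<tau> * (t - \<xi>)\<^sup>2)) * \<bar>(\<Prod>i=1..d. x i - t) / ?D ^ d\<bar> \<le> exp (- (\<tau> * (t - \<xi>)\<^sup>2)) * 1"
    by (intro mult_left_mono) auto
  then show ?thesis by (simp add: A1_integrand_def abs_mult)
qed

section \<open>The posterior predictive mean\<close>

theorem mainTheorem7:
  fixes n r d m k :: nat and T T0 \<tau> \<xi> :: real
    and y x :: "nat \<Rightarrow> real" and prior :: "real \<Rightarrow> real \<Rightarrow> real"
  assumes "1 \<le> r" "r \<le> n"
    and "inj_on y {1..n}"
    and "T0 = stop_time n r T y"
    and "d = num_failures n r T y"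
    and "1 \<le> d"
    and "\<And>i. i \<in> {1..d} \<Longrightarrow> x i = order_stat n y i"
    and "1 \<le> m" "1 \<le> k"
    and "\<tau> > 0"
    and prior: "\<exists>c>0. \<forall>\<mu> \<sigma>. \<sigma> > 0 \<longrightarrow> prior \<mu> \<sigma> = c * (1 / \<sigma> * exp (- (\<tau> * (\<mu> - \<xi>)\<^sup>2)))"
    and proper: "set_integrable lborel {..<x 1} (A1_integrand n d T0 x \<tau> \<xi>)"
  shows "integrable lborel (\<lambda>u. u * predictive_density m k n d T0 x prior u) \<and>
         set_integrable lborel {..<x 1}
           (\<lambda>t. sqrt (delta_star n d T0 x t) * g_fun t t 0 n T0 x \<tau> \<xi> k d) \<and>
         set_integrable lborel {..<x 1} (\<lambda>t. t * g_fun t t 0 n T0 x \<tau> \<xi> k d) \<and>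
         bayes_predictor m k n d T0 x prior =
           A1 n d T0 x \<tau> \<xi> *
             (Gamma (real m + 1/2) * Gamma (real d - 1/2) / (Gamma (real m) * Gamma (real d) * sqrt (real k))
                * (LINT t:{..<x 1}|lborel. sqrt (delta_star n d T0 x t) * g_fun t t 0 n T0 x \<tau> \<xi> k d)
              + (LINT t:{..<x 1}|lborel. t * g_fun t t 0 n T0 x \<tau> \<xi> k d))"
proof -
  let ?A = "A1_integrand n d T0 x \<tau> \<xi>"
  let ?\<delta> = "delta_star n d T0 x"
  let ?S = "{..<x 1}"
  note sample = hybrid_censored_sample[OF assms(1,2,4-7)]
  have pos: "?\<delta> \<mu> > 0" if "\<mu> \<in> ?S" for \<mu> using delta_star_pos \<open>1 \<le> d\<close> that by simp
  have g: "g_fun t t 0 n T0 x \<tau> \<xi> k d = ?A t" for t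
    by (simp add: g_fun_def A1_integrand_def)
  obtain C where C: "\<And>t. \<bar>sqrt (?\<delta> t)\<bar> \<le> C * (1 + \<bar>t - \<xi>\<bar>)"
    using sqrt_delta_star_linear_growth by blast
  note tail = A1_integrand_gaussian_tail[of d x _ n T0 \<tau> \<xi>, OF \<open>1 \<le> d\<close> sample(3)]
  have int_sqrt: "set_integrable lborel ?S (\<lambda>t. sqrt (?\<delta> t) * ?A t)"
    by (rule set_integrable_linear_growth_times_gaussian_tail[OF \<open>\<tau> > 0\<close> proper tail _ C]) auto
  have "\<bar>t\<bar> \<le> (1 + \<bar>\<xi>\<bar>) * (1 + \<bar>t - \<xi>\<bar>)" for t
  proof -
    have "\<bar>t\<bar> \<le> \<bar>\<xi>\<bar> + \<bar>t - \<xi>\<bar>" "0 \<le> \<bar>\<xi>\<bar> * \<bar>t - \<xi>\<bar>" by auto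
    moreover have "(1 + \<bar>\<xi>\<bar>) * (1 + \<bar>t - \<xi>\<bar>) = 1 + \<bar>\<xi>\<bar> + \<bar>t - \<xi>\<bar> + \<bar>\<xi>\<bar> * \<bar>t - \<xi>\<bar>"
      by (simp add: algebra_simps)
    ultimately show ?thesis by linarith
  qed
  then have int_id: "set_integrable lborel ?S (\<lambda>t. t * ?A t)"
    by (intro set_integrable_linear_growth_times_gaussian_tail[OF \<open>\<tau> > 0\<close> proper tail]) auto

  \<comment> \<open>The posterior is proportional to \<open>w \<mu> * \<kappa> d \<mu> \<sigma>\<close>, where \<open>\<kappa> a\<close> is the inverse gamma kernel of
     shape \<open>a\<close> and scale \<open>\<delta>\<^sup>* / 2\<close>, cut off to the parameter region.\<close>
  define w where "w = (\<lambda>\<mu>. exp (- (\<tau> * (\<mu> - \<xi>)\<^sup>2)) * (\<Prod>i=1..d. x i - \<mu>))"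
  have [measurable]: "w \<in> borel_measurable borel" unfolding w_def by measurable
  define \<kappa> where "\<kappa> = (\<lambda>a \<mu> \<sigma>. indicator ?S \<mu> * (indicator {0<..} \<sigma> *
       (\<sigma> powr (- a - 1) * exp (- (?\<delta> \<mu> / (2 * \<sigma>))))) :: real)"
  have powd: "w \<mu> / ?\<delta> \<mu> powr real d = ?A \<mu>" if "\<mu> \<in> ?S" for \<mu>
    using pos[OF that] by (simp add: w_def A1_integrand_def powr_realpow)
  have powd_id: "\<mu> * w \<mu> / ?\<delta> \<mu> powr real d = \<mu> * ?A \<mu>" if "\<mu> \<in> ?S" for \<mu>
    by (simp only: powd[OF that, symmetric] times_divide_eq_right)
  have powd': "w \<mu> / ?\<delta> \<mu> powr (real d - 1 / 2) = sqrt (?\<delta> \<mu>) * ?A \<mu>" if "\<mu> \<in> ?S" for \<mu>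
    using pos[OF that] by (simp add: w_def A1_integrand_def powr_diff powr_half_sqrt powr_realpow)
  have mix: "has_bochner_integral lborel (\<lambda>z. v (fst z) * \<kappa> a (fst z) (snd z))
      (Gamma a * 2 powr a * (LINT \<mu>:?S|lborel. F \<mu>))"
    if "a > 0" "v \<in> borel_measurable borel" "set_integrable lborel ?S F"
      and vF: "\<And>\<mu>. \<mu> \<in> ?S \<Longrightarrow> v \<mu> / ?\<delta> \<mu> powr a = F \<mu>" for a v F
  proof -
    have "set_integrable lborel ?S (\<lambda>\<mu>. v \<mu> / ?\<delta> \<mu> powr a) \<longleftrightarrow> set_integrable lborel ?S F"
      by (rule set_integrable_cong) (use vF in auto)
    moreover have "(LINT \<mu>:?S|lborel. v \<mu> / ?\<delta> \<mu> powr a) = (LINT \<mu>:?S|lborel. F \<mu>)"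
      by (rule set_lebesgue_integral_cong) (use vF in auto)
    ultimately show ?thesis
      using has_bochner_integral_inverse_gamma_mixture
          [where S = ?S and \<delta> = ?\<delta> and w = v, OF \<open>a > 0\<close> _ _ _ pos] that
      by (simp add: \<kappa>_def case_prod_beta' lborel_prod)
  qed

  obtain c where c: "c > 0"
    and c_prior: "\<And>\<mu> \<sigma>. \<sigma> > 0 \<Longrightarrow> prior \<mu> \<sigma> = c * (1 / \<sigma> * exp (- (\<tau> * (\<mu> - \<xi>)\<^sup>2)))"
    using prior by blast
  define c' where "c' = c * (fact n / fact (n - d))"
  have c': "c' > 0" using c by (simp add: c'_def)
  have joint: "likelihood n d T0 x \<mu> \<sigma> * prior \<mu> \<sigma> = c' * (w \<mu> * \<kappa> (real d) \<mu> \<sigma>)"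
    if "\<mu> < x 1" "\<sigma> > 0" for \<mu> \<sigma>
  proof -
    have "likelihood n d T0 x \<mu> \<sigma> = fact n / fact (n - d) *
        (1 / \<sigma> ^ d * (\<Prod>i=1..d. x i - \<mu>) * exp (- (1 / (2 * \<sigma>) * ?\<delta> \<mu>)))"
      using that sample(2) sample(3) by (intro likelihood_eq sample(1)) (auto intro: less_le_trans)
    moreover have "\<sigma> powr (- real d - 1) = 1 / \<sigma> ^ d * (1 / \<sigma>)"
      using that by (simp add: powr_diff powr_minus powr_realpow divide_inverse)
    ultimately show ?thesis
      using that by (simp add: c_prior \<kappa>_def c'_def w_def mult_ac)
  qed
  define I where "I = (LINT \<mu>:?S|lborel. ?A \<mu>)"
  define Z where "Z = (LINT z:?S \<times> {0<..}|lborel. likelihood n d T0 x (fst z) (snd z) * prior (fst z) (snd z))"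
  have Z: "Z = c' * (Gamma (real d) * 2 powr real d * I)"
  proof -
    have "Z = (LINT z|lborel. c' * (w (fst z) * \<kappa> (real d) (fst z) (snd z)))"
      unfolding Z_def set_lebesgue_integral_def
      by (rule Bochner_Integration.integral_cong) (auto simp: joint indicator_def \<kappa>_def)
    moreover have "has_bochner_integral lborel (\<lambda>z. w (fst z) * \<kappa> (real d) (fst z) (snd z))
        (Gamma (real d) * 2 powr real d * I)"
      unfolding I_def by (rule mix[OF _ _ proper powd]) (use \<open>1 \<le> d\<close> in auto)
    ultimately show ?thesis by (simp add: has_bochner_integral_iff)
  qed
  define N where "N = c' / Z"
  have Gd: "Gamma (real d) > 0" using \<open>1 \<le> d\<close> by (intro Gamma_real_pos) simp
  \<comment> \<open>If \<open>I = 0\<close>, both sides are 0, as \<open>inverse 0 = 0\<close>.\<close>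
  have N: "N * (Gamma (real d) * 2 powr real d) = A1 n d T0 x \<tau> \<xi>"
  proof -
    have "A1 n d T0 x \<tau> \<xi> = inverse I" by (simp add: A1_def I_def)
    then show ?thesis using c' Gd by (cases "I = 0") (auto simp: N_def Z field_simps)
  qed

  define q where "q = (\<lambda>z. N * (w (fst z) * \<kappa> (real d) (fst z) (snd z)))"
  have q: "posterior n d T0 x prior \<mu> \<sigma> = q (\<mu>, \<sigma>)" for \<mu> \<sigma>
    unfolding posterior_def Z_def[symmetric] by (auto simp: q_def N_def joint) (auto simp: \<kappa>_def)
  have "has_bochner_integral lborel (\<lambda>z. N * ((fst z * w (fst z)) * \<kappa> (real d) (fst z) (snd z)))
      (N * (Gamma (real d) * 2 powr real d * (LINT t:?S|lborel. t * ?A t)))"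
    by (intro has_bochner_integral_mult_right mix int_id powd_id) (use \<open>1 \<le> d\<close> in auto)
  then have location: "has_bochner_integral lborel (\<lambda>z. fst z * q z)
      (A1 n d T0 x \<tau> \<xi> * (LINT t:?S|lborel. t * ?A t))"
    by (simp add: q_def mult_ac flip: N)
  have \<kappa>_sqrt: "sqrt \<sigma> * \<kappa> (real d) \<mu> \<sigma> = \<kappa> (real d - 1 / 2) \<mu> \<sigma>" for \<mu> \<sigma>
  proof (cases "\<sigma> > 0")
    case True
    have "- (real d - 1 / 2) - 1 = 1 / 2 + (- real d - 1)" by simp
    then have "\<sigma> powr (- (real d - 1 / 2) - 1) = sqrt \<sigma> * \<sigma> powr (- real d - 1)"
      using True by (simp only: powr_add powr_half_sqrt)
    then show ?thesis by (simp add: \<kappa>_def)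
  qed (simp add: \<kappa>_def)
  have "has_bochner_integral lborel (\<lambda>z. N * (w (fst z) * \<kappa> (real d - 1 / 2) (fst z) (snd z)))
      (N * (Gamma (real d - 1 / 2) * 2 powr (real d - 1 / 2) * (LINT t:?S|lborel. sqrt (?\<delta> t) * ?A t)))"
    by (intro has_bochner_integral_mult_right mix int_sqrt powd') (use \<open>1 \<le> d\<close> in auto)
  then have scale: "has_bochner_integral lborel (\<lambda>z. sqrt (snd z) * q z)
      (N * (Gamma (real d - 1 / 2) * 2 powr (real d - 1 / 2) * (LINT t:?S|lborel. sqrt (?\<delta> t) * ?A t)))"
    by (simp add: q_def \<kappa>_sqrt[symmetric] mult_ac)

  have pred: "predictive_density m k n d T0 x prior u =
      (LINT \<mu>|lborel. LINT \<sigma>|lborel. repair_density m k \<mu> \<sigma> u * q (\<mu>, \<sigma>))" for u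
    unfolding predictive_density_def set_lebesgue_integral_def q
  proof (rule Bochner_Integration.integral_cong[OF refl])
    fix \<mu>
    have "(LINT \<sigma>|lborel. indicator {0<..} \<sigma> *\<^sub>R (repair_density m k \<mu> \<sigma> u * q (\<mu>, \<sigma>))) =
       (LINT \<sigma>|lborel. repair_density m k \<mu> \<sigma> u * q (\<mu>, \<sigma>))"
      by (rule Bochner_Integration.integral_cong) (auto simp: q_def \<kappa>_def indicator_def)
    moreover have "(LINT \<sigma>|lborel. repair_density m k \<mu> \<sigma> u * q (\<mu>, \<sigma>)) = 0"
      if "\<mu> \<notin> {..<min u (x 1)}"
    proof -
      have "repair_density m k \<mu> \<sigma> u * q (\<mu>, \<sigma>) = 0" for \<sigma>
        using that by (auto simp: repair_density_def q_def \<kappa>_def indicator_def)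
      then show ?thesis by (simp only: Bochner_Integration.integral_zero)
    qed
    ultimately show "indicator {..<min u (x 1)} \<mu> *\<^sub>R
        (LINT \<sigma>|lborel. indicator {0<..} \<sigma> *\<^sub>R (repair_density m k \<mu> \<sigma> u * q (\<mu>, \<sigma>))) =
       (LINT \<sigma>|lborel. repair_density m k \<mu> \<sigma> u * q (\<mu>, \<sigma>))"
      by (cases "\<mu> \<in> {..<min u (x 1)}") auto
  qed
  have "q \<in> borel_measurable (borel \<Otimes>\<^sub>M borel)" unfolding q_def \<kappa>_def by measurable
  then have qm: "q \<in> borel_measurable borel" by (simp add: borel_prod)
  have mean: "has_bochner_integral lborel (\<lambda>u. u * predictive_density m k n d T0 x prior u)
    (A1 n d T0 x \<tau> \<xi> * (LINT t:?S|lborel. t * ?A t) +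
     Gamma (real m + 1 / 2) / Gamma (real m) * sqrt (2 / real k) *
       (N * (Gamma (real d - 1 / 2) * 2 powr (real d - 1 / 2) * (LINT t:?S|lborel. sqrt (?\<delta> t) * ?A t))))"
    unfolding pred
    by (rule has_bochner_integral_predictive_mean[OF \<open>1 \<le> m\<close> \<open>1 \<le> k\<close> qm _ location scale])
      (simp add: q_def \<kappa>_def)
  \<comment> \<open>The powers of 2 cancel: \<open>sqrt 2\<close> from the mean excess, \<open>2 powr (d - 1/2)\<close> from the mean of
     \<open>sqrt \<sigma>\<close> and \<open>2 powr d\<close> from the normalising constant.\<close>
  have "(2::real) powr (real d - 1 / 2) = 2 powr real d / sqrt 2"
    by (simp add: powr_diff powr_half_sqrt)
  then have const: "sqrt (2 / real k) * (N * (Gamma (real d - 1 / 2) * 2 powr (real d - 1 / 2))) =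
      A1 n d T0 x \<tau> \<xi> * (Gamma (real d - 1 / 2) / (Gamma (real d) * sqrt (real k)))"
    using Gd \<open>1 \<le> k\<close> by (simp add: real_sqrt_divide field_simps flip: N)
  have "A1 n d T0 x \<tau> \<xi> * (LINT t:?S|lborel. t * ?A t) +
     Gamma (real m + 1 / 2) / Gamma (real m) * sqrt (2 / real k) *
       (N * (Gamma (real d - 1 / 2) * 2 powr (real d - 1 / 2) * (LINT t:?S|lborel. sqrt (?\<delta> t) * ?A t))) =
     A1 n d T0 x \<tau> \<xi> * (LINT t:?S|lborel. t * ?A t) +
     Gamma (real m + 1 / 2) / Gamma (real m) *
       (sqrt (2 / real k) * (N * (Gamma (real d - 1 / 2) * 2 powr (real d - 1 / 2)))) *
         (LINT t:?S|lborel. sqrt (?\<delta> t) * ?A t)"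
    by (simp only: mult_ac)
  also have "\<dots> = A1 n d T0 x \<tau> \<xi> *
     (Gamma (real m + 1 / 2) * Gamma (real d - 1 / 2) / (Gamma (real m) * Gamma (real d) * sqrt (real k))
        * (LINT t:?S|lborel. sqrt (?\<delta> t) * ?A t) + (LINT t:?S|lborel. t * ?A t))"
    unfolding const by (simp add: algebra_simps)
  finally show ?thesis
    using mean int_sqrt int_id by (simp add: g bayes_predictor_def has_bochner_integral_iff)
qed

end
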